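(* Let $(u_\star,\alpha_\star,\beta_\star)$ be a solution to the problem defining $\rho_n^{\mathrm{var}}$. Then, for all $i$ and all $x_i\in[0,1]$, $u_{i,\star}(x_i)=\alpha_{i,\star}+\beta_{i,\star}x_i$. In addition, an extremal distribution is given by $$p(x)=\prod_{i=1}^n\big((1-\mu_i)\delta_{x_i=0}+\mu_i\delta_{x_i=1}\big).$$
   Context: Let $n\geqslant1$, $t\geqslant0$, and let $\mu_1,\dots,\mu_n$ be the means of $n$ independent random variables taking their values in $[0,1]$. The variational problem for Hoeffding's inequality is $$\rho_n^{\mathrm{var}}=\inf_{u_1,\dots,u_n\geqslant0}\ \inf_{\alpha\in\mathbb{R}^n,\,\beta\in\mathbb{R}^n}\ \prod_{i=1}^n(\alpha_i+\beta_i\mu_i)$$ over functions $u_i:[0,1]\to\mathbb{R}^+$ and $\alpha,\beta\in\mathbb{R}^n$ such that $$\mathbf{1}_{\sum_{i=1}^n x_i\geqslant\sum_{i=1}^n\mu_i+nt}\leqslant\prod_{i=1}^n u_i(x_i)\quad\forall x\in[0,1]^n,\qquad u_i(x_i)\leqslant\alpha_i+\beta_ix_i\quad\forall i,\ \forall x_i\in[0,1].$$ A distribution is called extremal if it satisfies the bound under consideration with equality. Here this means that $p$ is a product of distributions $p_i$ on $[0,1]$ with means $\mu_i$ that attains the supremum of $\int_{[0,1]^n}\prod_{i=1}^n u_{i,\star}(x_i)\,dq_1(x_1)\cdots dq_n(x_n)$ over probability distributions $q_i$ on $[0,1]$ with $\int_0^1x_i\,dq_i(x_i)=\mu_i$,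 the value being $\rho_n^{\mathrm{var}}$. $\delta_{x=a}$ denotes the Dirac mass at $a$.
   Formalization: The claim fails for arbitrary solutions, as u is determined only up to slack (n=1, μ=1/2, t=1/4, α=0, β=4/3, u=1 on [3/4,1], else 0). Proved instead: α_i+β_i x_i is itself a solution, and both claims hold for solutions whose u cannot be enlarged for the given α, β. *)

theory Defs
  imports "HOL-Probability.Probability"
begin

text \<open>
  Points of $[0,1]^n$ and vectors of $\mathbb{R}^n$ are functions on \<^typ>\<open>nat\<close> of which only the
  values at indices below \<open>n\<close> matter; likewise only the values of \<open>u i\<close> on $[0,1]$ matter.
\<close>

definition hoeffding_feasible ::
    "nat \<Rightarrow> (nat \<Rightarrow> real) \<Rightarrow> real \<Rightarrow> (nat \<Rightarrow> real \<Rightarrow> real) \<Rightarrow> (nat \<Rightarrow> real) \<Rightarrow> (nat \<Rightarrow> real) \<Rightarrow> bool" where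
  "hoeffding_feasible n \<mu> t u \<alpha> \<beta> \<longleftrightarrow>
     (\<forall>i<n. \<forall>x\<in>{0..1}. 0 \<le> u i x) \<and>
     (\<forall>x. (\<forall>i<n. x i \<in> {0..1}) \<longrightarrow>
        of_bool ((\<Sum>i<n. x i) \<ge> (\<Sum>i<n. \<mu> i) + real n * t) \<le> (\<Prod>i<n. u i (x i))) \<and>
     (\<forall>i<n. \<forall>x\<in>{0..1}. u i x \<le> \<alpha> i + \<beta> i * x)"

definition hoeffding_objective ::
    "nat \<Rightarrow> (nat \<Rightarrow> real) \<Rightarrow> (nat \<Rightarrow> real) \<Rightarrow> (nat \<Rightarrow> real) \<Rightarrow> real" where
  "hoeffding_objective n \<mu> \<alpha> \<beta> = (\<Prod>i<n. \<alpha> i + \<beta> i * \<mu> i)"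

text \<open>
  The iterated infimum is taken over all feasible triples at once. For means in $[0,1]$ the set of
  values is nonempty (\<open>u = 1\<close>, \<open>\<alpha> = 1\<close>, \<open>\<beta> = 0\<close>) and bounded below by \<open>0\<close>, so the real infimum is
  the genuine one.
\<close>

definition rho_var :: "nat \<Rightarrow> (nat \<Rightarrow> real) \<Rightarrow> real \<Rightarrow> real" where
  "rho_var n \<mu> t = Inf {hoeffding_objective n \<mu> \<alpha> \<beta> | u \<alpha> \<beta>. hoeffding_feasible n \<mu> t u \<alpha> \<beta>}"

definition hoeffding_solution ::
    "nat \<Rightarrow> (nat \<Rightarrow> real) \<Rightarrow> real \<Rightarrow> (nat \<Rightarrow> real \<Rightarrow> real) \<Rightarrow> (nat \<Rightarrow> real) \<Rightarrow> (nat \<Rightarrow> real) \<Rightarrow> bool" where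
  "hoeffding_solution n \<mu> t u \<alpha> \<beta> \<longleftrightarrow>
     hoeffding_feasible n \<mu> t u \<alpha> \<beta> \<and> hoeffding_objective n \<mu> \<alpha> \<beta> = rho_var n \<mu> t"

text \<open>
  The objective does not involve \<open>u\<close>, so for given \<open>\<alpha>\<close>, \<open>\<beta>\<close> a solution may contain a needlessly
  small \<open>u\<close>; see \<open>solution_with_slack\<close> below. A solution is maximal if its \<open>u\<close> cannot be enlarged.
\<close>

definition hoeffding_maximal_solution ::
    "nat \<Rightarrow> (nat \<Rightarrow> real) \<Rightarrow> real \<Rightarrow> (nat \<Rightarrow> real \<Rightarrow> real) \<Rightarrow> (nat \<Rightarrow> real) \<Rightarrow> (nat \<Rightarrow> real) \<Rightarrow> bool" where
  "hoeffding_maximal_solution n \<mu> t u \<alpha> \<beta> \<longleftrightarrow>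
     hoeffding_solution n \<mu> t u \<alpha> \<beta> \<and>
     (\<forall>v. hoeffding_solution n \<mu> t v \<alpha> \<beta> \<longrightarrow> (\<forall>i<n. \<forall>x\<in>{0..1}. u i x \<le> v i x) \<longrightarrow>
        (\<forall>i<n. \<forall>x\<in>{0..1}. v i x = u i x))"

abbreviation unit_borel :: "real measure" where
  "unit_borel \<equiv> restrict_space borel {0..1}"

definition unit_distributions :: "real \<Rightarrow> real measure set" where
  "unit_distributions m =
     {q. prob_space q \<and> space q = {0..1} \<and> sets q = sets unit_borel \<and> (\<integral>x. x \<partial>q) = m}"

definition mean_families :: "nat \<Rightarrow> (nat \<Rightarrow> real) \<Rightarrow> (nat \<Rightarrow> real measure) set" where
  "mean_families n \<mu> = {q. \<forall>i<n. q i \<in> unit_distributions (\<mu> i)}"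

text \<open>
  Integrals are taken in $[0,\infty]$, where they and the supremum always exist; feasible \<open>u\<close> are
  nonnegative on $[0,1]$, so \<^const>\<open>ennreal\<close> truncates nothing.
\<close>

definition hoeffding_value :: "nat \<Rightarrow> (nat \<Rightarrow> real \<Rightarrow> real) \<Rightarrow> (nat \<Rightarrow> real) measure \<Rightarrow> ennreal" where
  "hoeffding_value n u P = (\<integral>\<^sup>+x. ennreal (\<Prod>i<n. u i (x i)) \<partial>P)"

definition hoeffding_extremal ::
    "nat \<Rightarrow> (nat \<Rightarrow> real) \<Rightarrow> real \<Rightarrow> (nat \<Rightarrow> real \<Rightarrow> real) \<Rightarrow> (nat \<Rightarrow> real) measure \<Rightarrow> bool" where
  "hoeffding_extremal n \<mu> t u P \<longleftrightarrow>
     (\<exists>p\<in>mean_families n \<mu>. P = PiM {..<n} p) \<and>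
     hoeffding_value n u P = (SUP q\<in>mean_families n \<mu>. hoeffding_value n u (PiM {..<n} q)) \<and>
     hoeffding_value n u P = ennreal (rho_var n \<mu> t)"

text \<open>The measure $(1-m)\,\delta_0 + m\,\delta_1$ on $[0,1]$.\<close>

definition two_point :: "real \<Rightarrow> real measure" where
  "two_point m = measure_of {0..1} (sets unit_borel)
     (\<lambda>A. ennreal (1 - m) * emeasure (return unit_borel 0) A +
          ennreal m * emeasure (return unit_borel 1) A)"

lemma space_two_point: "space (two_point m) = {0..1}"
  and sets_two_point: "sets (two_point m) = sets unit_borel"
proof -
  have *: "sets unit_borel \<subseteq> Pow {0..1::real}"
    using sets.space_closed[of unit_borel] by (simp add: space_restrict_space)
  show "space (two_point m) = {0..1}" using * by (simp add: two_point_def)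
  have "sigma_sets {0..1} (sets unit_borel) = sets unit_borel"
    using sets.sigma_sets_eq[of unit_borel] by (simp add: space_restrict_space)
  then show "sets (two_point m) = sets unit_borel" using * by (simp add: two_point_def)
qed

lemma emeasure_two_point:
  assumes "A \<in> sets unit_borel"
  shows "emeasure (two_point m) A = ennreal (1 - m) * indicator A 0 + ennreal m * indicator A 1"
proof -
  let ?f = "\<lambda>A. ennreal (1 - m) * emeasure (return unit_borel 0) A +
          ennreal m * emeasure (return unit_borel 1) A"
  have *: "emeasure (two_point m) A = ?f A"
  proof (rule emeasure_measure_of[OF two_point_def])
    show "countably_additive (sets (two_point m)) ?f"
      unfolding countably_additive_def sets_two_point
      by (auto simp: suminf_add[symmetric] ennreal_suminf_cmult
            suminf_emeasure subset_eq simp del: emeasure_return)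
    show "sets unit_borel \<subseteq> Pow {0..1::real}"
      using sets.space_closed[of unit_borel] by (simp add: space_restrict_space)
  qed (use assms in \<open>auto simp: positive_def sets_two_point\<close>)
  show ?thesis using assms by (simp add: * emeasure_return)
qed

lemma solution_with_slack:
  defines "u \<equiv> \<lambda>(i::nat) x::real. of_bool (x \<ge> 3/4)"
  shows "hoeffding_solution 1 (\<lambda>_. 1/2) (1/4) u (\<lambda>_. 0) (\<lambda>_. 4/3)"
    and "u 0 (1/2) \<noteq> 0 + 4/3 * (1/2)"
proof -
  have feas: "hoeffding_feasible 1 (\<lambda>_. 1/2) (1/4) u (\<lambda>_. 0) (\<lambda>_. 4/3)"
    by (auto simp: hoeffding_feasible_def u_def)
  have low: "2/3 \<le> hoeffding_objective 1 (\<lambda>_. 1/2) \<alpha> \<beta>"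
    if f: "hoeffding_feasible 1 (\<lambda>_. 1/2) (1/4) v \<alpha> \<beta>" for v \<alpha> \<beta>
  proof -
    have "1 \<le> v 0 (3/4)"
      using f[unfolded hoeffding_feasible_def, THEN conjunct2, THEN conjunct1,
          THEN spec, of "\<lambda>_. 3/4"] by simp
    moreover have "v 0 (3/4) \<le> \<alpha> 0 + \<beta> 0 * (3/4)" "v 0 0 \<le> \<alpha> 0 + \<beta> 0 * 0" "0 \<le> v 0 0"
    proof -
      have "v 0 x \<le> \<alpha> 0 + \<beta> 0 * x" "0 \<le> v 0 x" if "x \<in> {0..1}" for x
        using f that unfolding hoeffding_feasible_def by blast+
      from this[of "3/4"] this[of 0]
      show "v 0 (3/4) \<le> \<alpha> 0 + \<beta> 0 * (3/4)" "v 0 0 \<le> \<alpha> 0 + \<beta> 0 * 0" "0 \<le> v 0 0"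
        by auto
    qed
    ultimately show ?thesis by (simp add: hoeffding_objective_def)
  qed
  have "rho_var 1 (\<lambda>_. 1/2) (1/4) = 2/3"
    unfolding rho_var_def
  proof (rule cInf_eq_minimum)
    show "2/3 \<in> {hoeffding_objective 1 (\<lambda>_. 1/2) \<alpha> \<beta> |v \<alpha> \<beta>.
        hoeffding_feasible 1 (\<lambda>_. 1/2) (1/4) v \<alpha> \<beta>}"
      using feas by (force simp: hoeffding_objective_def)
  qed (use low in auto)
  then show "hoeffding_solution 1 (\<lambda>_. 1/2) (1/4) u (\<lambda>_. 0) (\<lambda>_. 4/3)"
    using feas by (simp add: hoeffding_solution_def hoeffding_objective_def)
  show "u 0 (1/2) \<noteq> 0 + 4/3 * (1/2)" by (simp add: u_def)
qed

end

theory Submission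
  imports Defs
begin

text \<open>
  Each majorant $\alpha_i + \beta_i x_i$ dominates $u_i \ge 0$, so replacing $u$ by its majorant
  keeps the triple feasible without changing the objective; this is the largest admissible $u$.
  Affine functions only see the mean of a distribution, so by independence every product of
  distributions with means $\mu_i$ gives the value $\prod_i (\alpha_i + \beta_i \mu_i)$. In
  particular every such product is extremal, the two-point one included.
\<close>

lemma feasible_majorant:
  assumes "hoeffding_feasible n \<mu> t u \<alpha> \<beta>"
  shows "hoeffding_feasible n \<mu> t (\<lambda>i x. \<alpha> i + \<beta> i * x) \<alpha> \<beta>"
proof -
  have nonneg: "0 \<le> u i x" and le: "u i x \<le> \<alpha> i + \<beta> i * x" if "i < n" "x \<in> {0..1}" for i x
    using assms that unfolding hoeffding_feasible_def by blast+
  have "of_bool ((\<Sum>i<n. x i) \<ge> (\<Sum>i<n. \<mu> i) + real n * t) \<le> (\<Prod>i<n. \<alpha> i + \<beta> i * x i)"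
    if x: "\<forall>i<n. x i \<in> {0..1}" for x
  proof -
    have "of_bool ((\<Sum>i<n. x i) \<ge> (\<Sum>i<n. \<mu> i) + real n * t) \<le> (\<Prod>i<n. u i (x i))"
      using assms x unfolding hoeffding_feasible_def by blast
    \<comment> \<open>A product is monotone in its factors only while the smaller ones are
      nonnegative; this is where 0 \<le> \<open>u i\<close> enters.\<close>
    also have "\<dots> \<le> (\<Prod>i<n. \<alpha> i + \<beta> i * x i)"
      using nonneg le x by (intro prod_mono) blast
    finally show ?thesis .
  qed
  then show ?thesis
    unfolding hoeffding_feasible_def using order_trans[OF nonneg le] by blast
qed

lemma solution_majorant:
  assumes "hoeffding_solution n \<mu> t u \<alpha> \<beta>"
  shows "hoeffding_solution n \<mu> t (\<lambda>i x. \<alpha> i + \<beta> i * x) \<alpha> \<beta>"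
  using assms feasible_majorant unfolding hoeffding_solution_def by blast

lemma solution_le_majorant:
  assumes "hoeffding_solution n \<mu> t u \<alpha> \<beta>" "i < n" "x \<in> {0..1}"
  shows "u i x \<le> \<alpha> i + \<beta> i * x"
  using assms unfolding hoeffding_solution_def hoeffding_feasible_def by blast

text \<open>Feasibility bounds every competitor with the same \<open>\<alpha>\<close> and
  \<open>\<beta>\<close> by the majorant, so a competitor lying above the majorant coincides with it
  on [0,1].\<close>

lemma maximal_solution_majorant:
  assumes "hoeffding_solution n \<mu> t u \<alpha> \<beta>"
  shows "hoeffding_maximal_solution n \<mu> t (\<lambda>i x. \<alpha> i + \<beta> i * x) \<alpha> \<beta>"
  unfolding hoeffding_maximal_solution_def
proof (intro conjI allI impI ballI)
  show "hoeffding_solution n \<mu> t (\<lambda>i x. \<alpha> i + \<beta> i * x) \<alpha> \<beta>"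
    using assms by (rule solution_majorant)
qed (meson antisym solution_le_majorant)

text \<open>The majorant is itself a solution lying above \<open>v\<close>, so testing the
  maximality of \<open>v\<close> against it forces equality.\<close>

lemma maximal_solution_eq_majorant:
  assumes "hoeffding_maximal_solution n \<mu> t v \<alpha> \<beta>" "i < n" "x \<in> {0..1}"
  shows "v i x = \<alpha> i + \<beta> i * x"
proof -
  have v: "hoeffding_solution n \<mu> t v \<alpha> \<beta>"
    using assms(1) by (simp add: hoeffding_maximal_solution_def)
  have "\<forall>i<n. \<forall>x\<in>{0..1}. \<alpha> i + \<beta> i * x = v i x"
    using assms(1) solution_majorant[OF v] solution_le_majorant[OF v]
    unfolding hoeffding_maximal_solution_def by blast
  then show ?thesis
    using assms(2,3) by simp
qed

lemma borel_measurable_unit_distribution: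
  fixes f :: "real \<Rightarrow> 'a::topological_space"
  assumes "q \<in> unit_distributions m" "f \<in> borel_measurable borel"
  shows "f \<in> borel_measurable q"
proof -
  have "sets q = sets unit_borel"
    using assms(1) by (simp add: unit_distributions_def)
  then show ?thesis
    using measurable_restrict_space1[OF assms(2)] measurable_cong_sets by blast
qed

lemma nn_integral_affine_unit_distribution:
  assumes q: "q \<in> unit_distributions m"
    and nonneg: "\<And>x. x \<in> {0..1} \<Longrightarrow> 0 \<le> a + b * x"
  shows "(\<integral>\<^sup>+x. ennreal (a + b * x) \<partial>q) = ennreal (a + b * m)"
proof -
  interpret prob_space q using q by (simp add: unit_distributions_def)
  have space: "space q = {0..1}" and mean: "(\<integral>x. x \<partial>q) = m"
    using q by (simp_all add: unit_distributions_def)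
  \<comment> \<open>Integrability gives \<open>mean\<close> its content: the Bochner integral of a
    non-integrable function is 0 by default. Here the identity is bounded by 1 on the space of
    \<open>q\<close>.\<close>
  have int: "integrable q (\<lambda>x. x)"
    by (rule integrable_const_bound[where B = 1])
      (auto simp: space intro!: AE_I2 borel_measurable_unit_distribution[OF q])
  have "(\<integral>\<^sup>+x. ennreal (a + b * x) \<partial>q) = ennreal (\<integral>x. a + b * x \<partial>q)"
    using int nonneg by (intro nn_integral_eq_integral AE_I2) (auto simp: space)
  also have "(\<integral>x. a + b * x \<partial>q) = a + b * m"
    using int by (simp add: mean prob_space)
  finally show ?thesis .
qed

lemma two_point_in_unit_distributions:
  assumes "0 \<le> m" "m \<le> 1"
  shows "two_point m \<in> unit_distributions m"
proof -
  have sets [measurable_cong]: "sets (two_point m) = sets unit_borel"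
    by (rule sets_two_point)
  have mem: "A \<in> sets unit_borel" if "A \<subseteq> {0..1}" "A \<in> sets borel" for A :: "real set"
    using that by (auto simp: sets_restrict_space_iff)
  \<comment> \<open>Both weights are nonnegative for \<open>m\<close> in [0,1], so
    \<open>ennreal\<close> truncates neither and they add up to 1.\<close>
  have "emeasure (two_point m) (space (two_point m)) = 1"
    using assms
    by (subst emeasure_two_point)
      (auto simp: space_two_point mem simp flip: ennreal_plus)
  then interpret prob_space "two_point m" by (rule prob_spaceI)
  \<comment> \<open>All mass sits at the endpoints, where the identity agrees with the indicator of
    {1}. The mean is therefore the mass at 1.\<close>
  have null: "emeasure (two_point m) {0<..<1} = 0"
    by (subst emeasure_two_point) (auto intro!: mem)
  have one: "emeasure (two_point m) {1} = ennreal m"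
    by (subst emeasure_two_point) (auto intro!: mem)
  have "{0<..<1} \<in> null_sets (two_point m)"
    using null by (auto simp: null_sets_def sets intro!: mem)
  then have "AE x in two_point m. x \<notin> {0<..<1}"
    by (rule AE_not_in)
  then have "AE x in two_point m. x = indicator {1} x"
    by (rule AE_mp) (auto simp: space_two_point indicator_def intro!: AE_I2)
  moreover have "(\<lambda>x. x) \<in> borel_measurable (two_point m)"
      "(indicator {1} :: real \<Rightarrow> real) \<in> borel_measurable (two_point m)"
    by (auto simp: measurable_cong_sets[OF sets refl] intro!: measurable_restrict_space1)
  ultimately have "(\<integral>x. x \<partial>two_point m) = (\<integral>x. indicator {1} x \<partial>two_point m)"
    by (intro integral_cong_AE)
  also have "\<dots> = m"
    using assms by (simp add: space_two_point measure_def one)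
  finally show ?thesis
    using prob_space_axioms by (simp add: unit_distributions_def space_two_point sets)
qed

text \<open>The right-hand side does not depend on \<open>q\<close>, which makes every product with
  the given means extremal. Agreement of \<open>v\<close> with the majorant is asked on [0,1] alone,
  since maximality determines \<open>v\<close> only there.\<close>

lemma hoeffding_value_affine:
  assumes q: "q \<in> mean_families n \<mu>"
    and v: "\<And>i x. i < n \<Longrightarrow> x \<in> {0..1} \<Longrightarrow> v i x = \<alpha> i + \<beta> i * x"
    and nonneg: "\<And>i x. i < n \<Longrightarrow> x \<in> {0..1} \<Longrightarrow> 0 \<le> \<alpha> i + \<beta> i * x"
    and \<mu>: "\<And>i. i < n \<Longrightarrow> \<mu> i \<in> {0..1}"
  shows "hoeffding_value n v (PiM {..<n} q) = ennreal (hoeffding_objective n \<mu> \<alpha> \<beta>)"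
proof -
  \<comment> \<open>Members of \<^const>\<open>mean_families\<close> are unconstrained beyond \<open>n\<close>, but
    \<^locale>\<open>product_sigma_finite\<close> needs all factors to be \<open>\<sigma>\<close>-finite.\<close>
  define r where "r i = (if i < n then q i else two_point 0)" for i
  have dist: "r i \<in> unit_distributions (\<mu> i)" if "i < n" for i
    using q that by (simp add: r_def mean_families_def)
  have "prob_space (r i)" for i
    using q two_point_in_unit_distributions[of 0]
    by (auto simp: r_def mean_families_def unit_distributions_def)
  then interpret product_sigma_finite r
    by (simp add: product_sigma_finite_def prob_space_imp_sigma_finite)
  have "PiM {..<n} q = PiM {..<n} r"
    by (rule PiM_cong) (simp_all add: r_def)
  then have "hoeffding_value n v (PiM {..<n} q) = (\<integral>\<^sup>+x. ennreal (\<Prod>i<n. v i (x i)) \<partial>PiM {..<n} r)"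
    by (simp add: hoeffding_value_def)
  also have "\<dots> = (\<integral>\<^sup>+x. (\<Prod>i<n. ennreal (\<alpha> i + \<beta> i * x i)) \<partial>PiM {..<n} r)"
  proof (rule nn_integral_cong)
    fix x assume "x \<in> space (PiM {..<n} r)"
    then have x: "x i \<in> {0..1}" if "i < n" for i
      using that dist[OF that] by (auto simp: space_PiM unit_distributions_def dest: PiE_mem)
    then have "(\<Prod>i<n. v i (x i)) = (\<Prod>i<n. \<alpha> i + \<beta> i * x i)"
      by (intro prod.cong) (auto simp: v)
    also have "ennreal \<dots> = (\<Prod>i<n. ennreal (\<alpha> i + \<beta> i * x i))"
      using x nonneg by (intro prod_ennreal[symmetric]) blast
    finally show "ennreal (\<Prod>i<n. v i (x i)) = (\<Prod>i<n. ennreal (\<alpha> i + \<beta> i * x i))" .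
  qed
  \<comment> \<open>Independence in the form of Tonelli: each factor depends on a single coordinate,
    so the integral over the product measure splits.\<close>
  also have "\<dots> = (\<Prod>i<n. \<integral>\<^sup>+x. ennreal (\<alpha> i + \<beta> i * x) \<partial>r i)"
    by (rule product_nn_integral_prod) (auto intro!: borel_measurable_unit_distribution[OF dist])
  also have "\<dots> = (\<Prod>i<n. ennreal (\<alpha> i + \<beta> i * \<mu> i))"
    using nonneg by (intro prod.cong nn_integral_affine_unit_distribution dist) auto
  \<comment> \<open>As \<mu> i lies in [0,1], the majorant is nonnegative there too, and
    \<open>ennreal\<close> can be pulled out of the product.\<close>
  also have "\<dots> = ennreal (hoeffding_objective n \<mu> \<alpha> \<beta>)"
    unfolding hoeffding_objective_def using nonneg \<mu> by (intro prod_ennreal) blast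
  finally show ?thesis .
qed

lemma (in prob_space) expectation_in_unit_interval:
  fixes X :: "'a \<Rightarrow> real"
  assumes "\<And>\<omega>. \<omega> \<in> space M \<Longrightarrow> X \<omega> \<in> {0..1}"
  shows "expectation X \<in> {0..1}"
proof (cases "integrable M X")
  case True
  then have "expectation X \<le> 1"
    using assms by (intro integral_le_const AE_I2) auto
  moreover have "0 \<le> expectation X"
    using assms by (intro Bochner_Integration.integral_nonneg) auto
  ultimately show ?thesis by simp
\<comment> \<open>A non-integrable \<open>X\<close> has expectation 0 by convention, which lies in
  the interval as well.\<close>
qed (simp add: not_integrable_integral_eq)

text \<open>Equality with the affine function can fail for a solution whose \<open>u\<close> is
  needlessly small, so it is claimed for maximal solutions. The first conjunct shows that one exists
  for the given \<open>\<alpha>\<close> and \<open>\<beta>\<close>, so the second is not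
  vacuous.\<close>

theorem proposition10:
  fixes M :: "'a measure" and X :: "nat \<Rightarrow> 'a \<Rightarrow> real"
    and n :: nat and t :: real and \<mu> \<alpha> \<beta> :: "nat \<Rightarrow> real" and u :: "nat \<Rightarrow> real \<Rightarrow> real"
  assumes "n \<ge> 1" and "t \<ge> 0"
    and "prob_space M"
    and "prob_space.indep_vars M (\<lambda>_. borel) X {..<n}"
    and "\<And>i \<omega>. i < n \<Longrightarrow> \<omega> \<in> space M \<Longrightarrow> X i \<omega> \<in> {0..1}"
    and "\<And>i. i < n \<Longrightarrow> \<mu> i = prob_space.expectation M (X i)"
    and "hoeffding_solution n \<mu> t u \<alpha> \<beta>"
  shows "hoeffding_maximal_solution n \<mu> t (\<lambda>i x. \<alpha> i + \<beta> i * x) \<alpha> \<beta> \<and>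
    (\<forall>v. hoeffding_maximal_solution n \<mu> t v \<alpha> \<beta> \<longrightarrow>
       (\<forall>i<n. \<forall>x\<in>{0..1}. v i x = \<alpha> i + \<beta> i * x) \<and>
       hoeffding_extremal n \<mu> t v (PiM {..<n} (\<lambda>i. two_point (\<mu> i))))"
proof (intro conjI allI impI ballI)
  show "hoeffding_maximal_solution n \<mu> t (\<lambda>i x. \<alpha> i + \<beta> i * x) \<alpha> \<beta>"
    by (rule maximal_solution_majorant) fact
next
  fix v i and x :: real
  assume "hoeffding_maximal_solution n \<mu> t v \<alpha> \<beta>" "i < n" "x \<in> {0..1}"
  then show "v i x = \<alpha> i + \<beta> i * x"
    by (rule maximal_solution_eq_majorant)
next
  fix v
  assume v: "hoeffding_maximal_solution n \<mu> t v \<alpha> \<beta>"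
  interpret prob_space M by fact
  have \<mu>: "\<mu> i \<in> {0..1}" if "i < n" for i
    using expectation_in_unit_interval[of "X i"] assms(5,6) that by metis
  have nonneg: "0 \<le> \<alpha> i + \<beta> i * x" if "i < n" "x \<in> {0..1}" for i x
    using solution_majorant[OF assms(7)] that
    unfolding hoeffding_solution_def hoeffding_feasible_def by blast
  have "hoeffding_value n v (PiM {..<n} q) = ennreal (hoeffding_objective n \<mu> \<alpha> \<beta>)"
    if "q \<in> mean_families n \<mu>" for q
    using that maximal_solution_eq_majorant[OF v] nonneg \<mu> by (rule hoeffding_value_affine)
  then have val: "hoeffding_value n v (PiM {..<n} q) = ennreal (rho_var n \<mu> t)"
    if "q \<in> mean_families n \<mu>" for q
    using that assms(7) by (simp add: hoeffding_solution_def)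
  have mem: "(\<lambda>i. two_point (\<mu> i)) \<in> mean_families n \<mu>"
    using \<mu> by (auto simp: mean_families_def intro!: two_point_in_unit_distributions)
  \<comment> \<open>The supremum of a constant is that constant only over a nonempty index set; the
    two-point family is the witness.\<close>
  have "(SUP q\<in>mean_families n \<mu>. hoeffding_value n v (PiM {..<n} q)) = ennreal (rho_var n \<mu> t)"
    using mem val by (intro SUP_eq_const) auto
  then show "hoeffding_extremal n \<mu> t v (PiM {..<n} (\<lambda>i. two_point (\<mu> i)))"
    unfolding hoeffding_extremal_def using mem val by auto
qed

end
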